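(* Let $G$ be a connected, non-complete, strictly chordal graph. Then $G$ is a strictly interval graph if and only if $D(CC(G))$ is a path.
   Context: All graphs are finite, simple and connected. For a vertex $v$, $N(v)$ is its set of neighbours and $N[v]=N(v)\cup\{v\}$. Two vertices $u,v$ are true twins if $N[u]=N[v]$. A vertex is simplicial if its neighbourhood is a clique. A graph is chordal if it has no induced cycle of length at least 4. A block graph is a connected graph in which every block (maximal 2-connected subgraph or bridge) is a clique. A graph is strictly chordal if it is obtained from a block graph by adding zero or more true twins to each vertex. An interval graph is the intersection graph of a family of intervals of the real line. A strictly interval graph is a graph that is both strictly chordal and interval. A critical clique of $G$ is a maximal set of vertices that are pairwise true twins (these sets partition $V(G)$). The critical clique graph $CC(G)$ is the graph whose vertices are the critical cliques of $G$, two critical cliques $Q_i,Q_j$ being adjacent iff some vertex of $Q_i$ is adjacent in $G$ to some vertex of $Q_j$. For a chordal graph $X$, the derived graph $D(X)$ is the induced subgraph of $X$ obtained by deleting all simplicial vertices of $X$. *)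

theory Defs
  imports "HOL-Analysis.Analysis" "HOL-Library.Disjoint_Sets" "Graph_Theory.Graph_Theory"
begin

text \<open>
  A finite simple graph is a finite loop-free symmetric digraph without parallel arcs, that is,
  an instance of the locale \<^locale>\<open>graph\<close> (or \<^locale>\<open>pair_graph\<close>, when arcs are pairs of vertices).
  Every predicate below that names a class of graphs includes this condition.  The library's
  \<^const>\<open>Digraph_Component.connected\<close> requires a nonempty vertex set.
\<close>

definition complete_graph :: "('a, 'b) pre_digraph \<Rightarrow> bool" where
  "complete_graph G \<longleftrightarrow> (\<exists>n. complete_digraph n G)"

definition clique :: "('a, 'b) pre_digraph \<Rightarrow> 'a set \<Rightarrow> bool" where
  "clique G S \<longleftrightarrow> S \<subseteq> verts G \<and> (\<forall>u\<in>S. \<forall>v\<in>S. u \<noteq> v \<longrightarrow> u \<rightarrow>\<^bsub>G\<^esub> v)"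

definition nbhd :: "('a, 'b) pre_digraph \<Rightarrow> 'a \<Rightarrow> 'a set" where
  "nbhd G v = {u \<in> verts G. v \<rightarrow>\<^bsub>G\<^esub> u}"

definition closed_nbhd :: "('a, 'b) pre_digraph \<Rightarrow> 'a \<Rightarrow> 'a set" where
  "closed_nbhd G v = insert v (nbhd G v)"

definition true_twins :: "('a, 'b) pre_digraph \<Rightarrow> 'a \<Rightarrow> 'a \<Rightarrow> bool" where
  "true_twins G u v \<longleftrightarrow> closed_nbhd G u = closed_nbhd G v"

definition simplicial :: "('a, 'b) pre_digraph \<Rightarrow> 'a \<Rightarrow> bool" where
  "simplicial G v \<longleftrightarrow> clique G (nbhd G v)"


text \<open>
  The condition \<^term>\<open>graph B\<close> is needed: a subgraph in the sense of \<^const>\<open>subgraph\<close> may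
  contain only one of the two opposite arcs that make up an edge.
\<close>

definition two_connected :: "('a, 'b) pre_digraph \<Rightarrow> bool" where
  "two_connected B \<longleftrightarrow> graph B \<and> card (verts B) \<ge> 3 \<and> Digraph_Component.connected B \<and>
     (\<forall>v\<in>verts B. Digraph_Component.connected (pre_digraph.del_vert B v))"

definition del_edge :: "('a, 'b) pre_digraph \<Rightarrow> 'a \<Rightarrow> 'a \<Rightarrow> ('a, 'b) pre_digraph" where
  "del_edge G u v = G\<lparr>arcs := {e \<in> arcs G. {tail G e, head G e} \<noteq> {u, v}}\<rparr>"

definition bridge :: "('a, 'b) pre_digraph \<Rightarrow> 'a \<Rightarrow> 'a \<Rightarrow> bool" where
  "bridge G u v \<longleftrightarrow> u \<rightarrow>\<^bsub>G\<^esub> v \<and> \<not> u \<rightarrow>\<^sup>*\<^bsub>del_edge G u v\<^esub> v"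

definition block :: "('a, 'b) pre_digraph \<Rightarrow> ('a, 'b) pre_digraph \<Rightarrow> bool" where
  "block G B \<longleftrightarrow> pre_digraph.max_subgraph G two_connected B \<or>
     (\<exists>u v. bridge G u v \<and> B = G \<restriction> {u, v})"

definition block_graph :: "('a, 'b) pre_digraph \<Rightarrow> bool" where
  "block_graph G \<longleftrightarrow> graph G \<and> Digraph_Component.connected G \<and>
     (\<forall>B. block G B \<longrightarrow> complete_graph B)"


text \<open>
  In \<open>add_true_twins H T\<close> each vertex \<open>x\<close> of \<open>H\<close> receives the elements of \<open>T x\<close> as new true twins
  (none if \<open>T x = {}\<close>), so that \<open>x\<close> is replaced by the clique \<open>insert x (T x)\<close>.
\<close>

definition add_true_twins :: "'a pair_pre_digraph \<Rightarrow> ('a \<Rightarrow> 'a set) \<Rightarrow> 'a pair_pre_digraph" where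
  "add_true_twins H T =
     \<lparr> pverts = (\<Union>x\<in>pverts H. insert x (T x)),
       parcs = {(u, v). u \<noteq> v \<and> (\<exists>x\<in>pverts H. \<exists>y\<in>pverts H.
          u \<in> insert x (T x) \<and> v \<in> insert y (T y) \<and> (x = y \<or> (x, y) \<in> parcs H))} \<rparr>"

definition strictly_chordal :: "'a pair_pre_digraph \<Rightarrow> bool" where
  "strictly_chordal G \<longleftrightarrow> (\<exists>H T. block_graph (with_proj H) \<and>
     (\<forall>x\<in>pverts H. finite (T x) \<and> T x \<inter> pverts H = {}) \<and>
     disjoint_family_on T (pverts H) \<and> G = add_true_twins H T)"

definition interval_graph :: "('a, 'b) pre_digraph \<Rightarrow> bool" where
  "interval_graph G \<longleftrightarrow> graph G \<and> (\<exists>I :: 'a \<Rightarrow> real set.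
     (\<forall>v\<in>verts G. is_interval (I v) \<and> I v \<noteq> {}) \<and>
     (\<forall>u\<in>verts G. \<forall>v\<in>verts G. u \<noteq> v \<longrightarrow> (u \<rightarrow>\<^bsub>G\<^esub> v \<longleftrightarrow> I u \<inter> I v \<noteq> {})))"

definition strictly_interval :: "'a pair_pre_digraph \<Rightarrow> bool" where
  "strictly_interval G \<longleftrightarrow> strictly_chordal G \<and> interval_graph (with_proj G)"


definition critical_clique :: "('a, 'b) pre_digraph \<Rightarrow> 'a set \<Rightarrow> bool" where
  "critical_clique G Q \<longleftrightarrow> Q \<noteq> {} \<and> Q \<subseteq> verts G \<and> pairwise (true_twins G) Q \<and>
     (\<forall>Q'. Q \<subseteq> Q' \<and> Q' \<subseteq> verts G \<and> pairwise (true_twins G) Q' \<longrightarrow> Q' = Q)"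

definition critical_clique_graph :: "('a, 'b) pre_digraph \<Rightarrow> 'a set pair_pre_digraph" where
  "critical_clique_graph G =
     \<lparr> pverts = {Q. critical_clique G Q},
       parcs = {(Q, R). critical_clique G Q \<and> critical_clique G R \<and> Q \<noteq> R \<and>
          (\<exists>u\<in>Q. \<exists>v\<in>R. u \<rightarrow>\<^bsub>G\<^esub> v)} \<rparr>"

definition derived_graph :: "('a, 'b) pre_digraph \<Rightarrow> ('a, 'b) pre_digraph" where
  "derived_graph X = X \<restriction> {v \<in> verts X. \<not> simplicial X v}"

text \<open>A single vertex is a path; the empty graph is not.\<close>

definition path_graph :: "('a, 'b) pre_digraph \<Rightarrow> bool" where
  "path_graph P \<longleftrightarrow> graph P \<and> (\<exists>xs. xs \<noteq> [] \<and> distinct xs \<and> set xs = verts P \<and>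
     (\<forall>i<length xs. \<forall>j<length xs. xs ! i \<rightarrow>\<^bsub>P\<^esub> xs ! j \<longleftrightarrow> j = Suc i \<or> i = Suc j))"

end

theory Submission
  imports Defs
begin

text \<open>
  Let \<open>G\<close> arise from a block graph \<open>H\<close> by adding true twins.  Every critical clique of \<open>G\<close> contains
  a vertex of \<open>H\<close>, so \<open>CC(G)\<close> is an induced subgraph of \<open>H\<close>.  It is connected, has no two true
  twins, and each of its cycles spans a clique, because a cycle of \<open>H\<close> lies in a block.  Moreover
  \<open>G\<close> is interval iff \<open>CC(G)\<close> is.

  Let \<open>S\<close> be the set of non-simplicial vertices of \<open>CC(G)\<close>.  For each edge \<open>av\<close> with \<open>a \<in> S\<close> there
  is a neighbour of \<open>a\<close> outside the closed neighbourhood of \<open>v\<close>.  Hence a triangle in \<open>S\<close> extends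
  to a net, and a claw with its leaves in \<open>S\<close> to a subdivided claw; both contain an asteroidal
  triple, which an interval graph does not have.  So if \<open>CC(G)\<close> is interval, a longest path in
  the connected graph induced on \<open>S\<close> exhausts it.  Conversely, if \<open>S\<close> induces a path, the simplicial
  vertices are pairwise non-adjacent, each is adjacent to one vertex or to two consecutive vertices
  of the path, and no two to the same pair; intervals are then easily written down.
\<close>

section \<open>Connected graphs in which cycles span cliques\<close>

text \<open>One of three reals lies between the other two, and the interval that holds these two
  would have to hold it as well.\<close>

lemma no_point_between_three:
  fixes x y z :: real
  assumes "is_interval P" "x \<in> P" "y \<in> P" "z \<notin> P"
    and "is_interval Q" "y \<in> Q" "z \<in> Q" "x \<notin> Q"
    and "is_interval R" "x \<in> R" "z \<in> R" "y \<notin> R"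
  shows False
  using assms unfolding is_interval_1 by (metis linorder_le_cases)

text \<open>A representation of a bare vertex set and relation, so that one notion serves both
  \<open>G\<close> and its critical clique graph.\<close>

definition interval_model :: "'a set \<Rightarrow> ('a \<Rightarrow> 'a \<Rightarrow> bool) \<Rightarrow> ('a \<Rightarrow> real set) \<Rightarrow> bool" where
  "interval_model V E I \<longleftrightarrow> (\<forall>v\<in>V. is_interval (I v) \<and> I v \<noteq> {}) \<and>
     (\<forall>u\<in>V. \<forall>v\<in>V. u \<noteq> v \<longrightarrow> (E u v \<longleftrightarrow> I u \<inter> I v \<noteq> {}))"

text \<open>An abstraction of \<open>CC(G)\<close>. Complete blocks enter through
  \<open>cycle_clique\<close>, which mentions no subgraphs and passes to induced subgraphs at
  once.\<close>

locale clique_cycle_graph =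
  fixes V :: "'b set" and E :: "'b \<Rightarrow> 'b \<Rightarrow> bool"
  assumes finite_V: "finite V"
    and E_in_V: "E u v \<Longrightarrow> u \<in> V"
    and E_sym: "E u v \<Longrightarrow> E v u"
    and E_irrefl: "\<not> E u u"
    and E_connected: "u \<in> V \<Longrightarrow> v \<in> V \<Longrightarrow> E\<^sup>*\<^sup>* u v"
    and cycle_clique: "\<lbrakk>distinct xs; 3 \<le> length xs; successively E xs; E (last xs) (hd xs);
      u \<in> set xs; v \<in> set xs; u \<noteq> v\<rbrakk> \<Longrightarrow> E u v"
    and twin_free: "\<lbrakk>u \<in> V; v \<in> V; \<And>w. u = w \<or> E u w \<longleftrightarrow> v = w \<or> E v w\<rbrakk> \<Longrightarrow> u = v"
begin

section \<open>The non-simplicial vertices, which span \<open>D(CC(G))\<close>\<close>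

definition S :: "'b set" where
  "S = {v \<in> V. \<exists>p q. E v p \<and> E v q \<and> p \<noteq> q \<and> \<not> E p q}"

lemma E_commute: "E u v \<longleftrightarrow> E v u"
  using E_sym by blast

text \<open>Adjacent vertices differ by \<open>E_irrefl\<close>, so only the diagonals have to be
  kept distinct. Read backwards: two distinct non-adjacent vertices have at most one common
  neighbour.\<close>

lemma four_cycle: "\<lbrakk>E a b; E b c; E c d; E d a; a \<noteq> c; b \<noteq> d\<rbrakk> \<Longrightarrow> E a c"
  using cycle_clique[of "[a,b,c,d]" a c] E_irrefl by auto

lemma five_cycle: "\<lbrakk>E a b; E b c; E c d; E d e; E e a; distinct [a,b,c,d,e]\<rbrakk> \<Longrightarrow> E a c"
  using cycle_clique[of "[a,b,c,d,e]" a c] E_irrefl by auto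

text \<open>Of two non-adjacent neighbours of \<open>a\<close>, one will do: if both were adjacent
  to \<open>v\<close>, the four-cycle \<open>p a q v\<close> would make them adjacent, and if one is
  \<open>v\<close>, the other is not adjacent to it.\<close>

lemma obtain_private_neighbour:
  assumes "a \<in> S" "E a v"
  obtains p where "E a p" "p \<noteq> v" "\<not> E p v"
proof -
  obtain p q where pq: "E a p" "E a q" "p \<noteq> q" "\<not> E p q" using assms by (auto simp: S_def)
  then have "p \<noteq> v \<and> \<not> E p v \<or> q \<noteq> v \<and> \<not> E q v"
    using four_cycle[of p a q v] assms(2) E_sym E_irrefl by metis
  with that pq show thesis by blast
qed

text \<open>Along a walk from \<open>s\<close>, keep a vertex \<open>w\<close> of \<open>S\<close> at distance at most 1 from the current
  vertex.  If the next vertex is at distance 2 from \<open>w\<close>, then the current one has two non-adjacent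
  neighbours, so it lies in \<open>S\<close> and replaces \<open>w\<close>.\<close>

lemma reach_within_S:
  assumes "s \<in> S" "v \<in> V"
  shows "\<exists>w\<in>S. (\<lambda>x y. E x y \<and> y \<in> S)\<^sup>*\<^sup>* s w \<and> (w = v \<or> E w v)"
proof -
  have "E\<^sup>*\<^sup>* s v" using E_connected assms by (auto simp: S_def)
  then show ?thesis
  proof (induction rule: rtranclp_induct)
    case base
    then show ?case using assms by auto
  next
    case (step v v')
    then obtain w where w: "w \<in> S" "(\<lambda>x y. E x y \<and> y \<in> S)\<^sup>*\<^sup>* s w" "w = v \<or> E w v" by blast
    show ?case
    proof (cases "w = v \<or> w = v' \<or> E w v'")
      case True
      with w step.hyps(2) show ?thesis by blast
    next
      case False
      then have "E w v" using w by blast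
      then have "v \<in> S"
        unfolding S_def using False step.hyps(2) E_sym E_in_V by blast
      with w(2) \<open>E w v\<close> have "(\<lambda>x y. E x y \<and> y \<in> S)\<^sup>*\<^sup>* s v"
        by (simp add: rtranclp.rtrancl_into_rtrancl)
      with \<open>v \<in> S\<close> step.hyps(2) show ?thesis by blast
    qed
  qed
qed

lemma S_connected:
  assumes "s \<in> S" "v \<in> S"
  shows "(\<lambda>x y. E x y \<and> y \<in> S)\<^sup>*\<^sup>* s v"
proof -
  have "v \<in> V" using assms by (simp add: S_def)
  then show ?thesis
    using reach_within_S[OF assms(1)] assms(2) by (metis (no_types, lifting) rtranclp.rtrancl_into_rtrancl)
qed

text \<open>If every vertex is simplicial, walks shorten to single edges, so connectedness makes the
  graph complete and all vertices become twins.\<close>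

lemma S_nonempty:
  assumes "u \<in> V" "v \<in> V" "u \<noteq> v"
  shows "S \<noteq> {}"
proof
  assume "S = {}"
  then have tr: "E a b" if "E v a" "E v b" "a \<noteq> b" for v a b
    using that E_in_V by (auto simp: S_def)
  have compl: "a = b \<or> E a b" if "a \<in> V" "b \<in> V" for a b
    using E_connected[OF that]
  proof (induction rule: rtranclp_induct)
    case (step y z)
    then show ?case using tr E_sym by metis
  qed auto
  have "u = v"
    using twin_free[OF assms(1,2)] compl E_in_V E_sym assms(1,2) by metis
  with assms show False by blast
qed

section \<open>Interval models exclude asteroidal triples\<close>

lemma interval_walk:
  assumes "interval_model V E I" "set us \<subseteq> V" "successively E us"
  shows "Topological_Spaces.connected (\<Union>u\<in>set us. I u)"
  using assms(2,3)
proof (induction us rule: induct_list012)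
  case (2 x)
  then show ?case using assms(1) by (simp add: interval_model_def is_interval_connected_1)
next
  case (3 x y zs)
  have "Topological_Spaces.connected (I x)"
    using assms(1) 3 by (simp add: interval_model_def is_interval_connected_1)
  moreover have "Topological_Spaces.connected (\<Union>u\<in>set (y # zs). I u)"
    using 3 by simp
  moreover have "I x \<inter> (\<Union>u\<in>set (y # zs). I u) \<noteq> {}"
  proof -
    have "E x y" "x \<in> V" "y \<in> V" "x \<noteq> y" using 3 E_irrefl by auto
    then have "I x \<inter> I y \<noteq> {}" using assms(1) by (auto simp: interval_model_def)
    then show ?thesis by auto
  qed
  ultimately have "Topological_Spaces.connected (I x \<union> (\<Union>u\<in>set (y # zs). I u))"
    by (rule connected_Un)
  then show ?case by simp
qed simp

text \<open>Each walk contains two of \<open>x\<close>, \<open>y\<close>, \<open>z\<close> and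
  avoids the closed neighbourhood of the third. Its intervals unite to an interval that covers those
  of the two and misses that of the third, which cannot hold for all three choices.\<close>

lemma no_asteroidal_triple:
  assumes I: "interval_model V E I"
    and V: "set ps \<subseteq> V" "set qs \<subseteq> V" "set rs \<subseteq> V"
    and P: "successively E ps" "x \<in> set ps" "y \<in> set ps" "\<forall>u\<in>set ps. u \<noteq> z \<and> \<not> E u z"
    and Q: "successively E qs" "y \<in> set qs" "z \<in> set qs" "\<forall>u\<in>set qs. u \<noteq> x \<and> \<not> E u x"
    and R: "successively E rs" "x \<in> set rs" "z \<in> set rs" "\<forall>u\<in>set rs. u \<noteq> y \<and> \<not> E u y"
  shows False
proof -
  have xyz: "x \<in> V" "y \<in> V" "z \<in> V" using V P Q by auto
  then have "I x \<noteq> {}" "I y \<noteq> {}" "I z \<noteq> {}" using I by (simp_all add: interval_model_def)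
  then obtain a b c where abc: "a \<in> I x" "b \<in> I y" "c \<in> I z" by auto
  have disj: "p \<notin> (\<Union>u\<in>set us. I u)"
    if "\<forall>u\<in>set us. u \<noteq> v \<and> \<not> E u v" "v \<in> V" "set us \<subseteq> V" "p \<in> I v" for us v p
  proof
    assume "p \<in> (\<Union>u\<in>set us. I u)"
    then obtain u where u: "u \<in> set us" "p \<in> I u" by blast
    then have "I u \<inter> I v \<noteq> {}" "u \<in> V" "u \<noteq> v" using that by auto
    then have "E u v" using \<open>v \<in> V\<close> I by (simp add: interval_model_def)
    with that u show False by blast
  qed
  have iv: "is_interval (\<Union>u\<in>set us. I u)" if "set us \<subseteq> V" "successively E us" for us
    using interval_walk[OF I that] by (simp add: is_interval_connected_1)
  show False
    by (rule no_point_between_three[OF iv[OF V(1) P(1)] _ _ disj[OF P(4) xyz(3) V(1) abc(3)]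
        iv[OF V(2) Q(1)] _ _ disj[OF Q(4) xyz(1) V(2) abc(1)]
        iv[OF V(3) R(1)] _ _ disj[OF R(4) xyz(2) V(3) abc(2)]])
      (use abc P Q R in auto)
qed

text \<open>Private neighbours \<open>p\<close>, \<open>q\<close>, \<open>r\<close> of the corners
  are the pendant vertices of a net and form the asteroidal triple.\<close>

lemma no_triangle_in_S:
  assumes I: "interval_model V E I" and S: "a \<in> S" "b \<in> S" "c \<in> S" and E: "E a b" "E b c" "E a c"
  shows False
proof -
  have pend: "\<exists>p. E a p \<and> p \<noteq> b \<and> p \<noteq> c \<and> \<not> E p b \<and> \<not> E p c"
    if "a \<in> S" "E a b" "E a c" "E b c" for a b c
  proof -
    note prem = that
    obtain p where "E a p" "p \<noteq> b" "\<not> E p b" by (rule obtain_private_neighbour[of a b]) (use prem in auto)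
    \<comment> \<open>If \<open>p\<close> were adjacent to \<open>c\<close>, the four-cycle
      \<open>p a b c\<close> would have the chord \<open>p b\<close>.\<close>
    moreover from this have "p \<noteq> c" "\<not> E p c"
      using four_cycle[of p a b c] prem E_sym E_irrefl by blast+
    ultimately show ?thesis by blast
  qed
  obtain p where p: "E a p" "p \<noteq> b" "p \<noteq> c" "\<not> E p b" "\<not> E p c" using pend[of a b c] S E by blast
  obtain q where q: "E b q" "q \<noteq> a" "q \<noteq> c" "\<not> E q a" "\<not> E q c"
    using pend[of b a c] S E E_sym by blast
  obtain r where r: "E c r" "r \<noteq> a" "r \<noteq> b" "\<not> E r a" "\<not> E r b"
    using pend[of c a b] S E E_sym by blast
  have pq: "\<not> E p q" "p \<noteq> q" using four_cycle[of p a b q] p q E E_sym by blast+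
  have pr: "\<not> E p r" "p \<noteq> r" using four_cycle[of p a c r] p r E E_sym by blast+
  have qr: "\<not> E q r" "q \<noteq> r" using four_cycle[of q b c r] q r E E_sym by blast+
  note sym = E_sym[OF E(1)] E_sym[OF E(2)] E_sym[OF E(3)] E_sym[OF p(1)] E_sym[OF q(1)] E_sym[OF r(1)]
  note V = E_in_V[OF E(1)] E_in_V[OF E(2)] E_in_V[OF r(1)] E_in_V[OF sym(4)] E_in_V[OF sym(5)] E_in_V[OF sym(6)]
  have A: "\<forall>u\<in>set [p,a,b,q]. u \<noteq> r \<and> \<not> E u r"
    using p q r pq pr qr by (simp add: E_commute)
  have B: "\<forall>u\<in>set [q,b,c,r]. u \<noteq> p \<and> \<not> E u p"
    using p q r pq pr qr by (simp add: E_commute)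
  have C: "\<forall>u\<in>set [p,a,c,r]. u \<noteq> q \<and> \<not> E u q"
    using p q r pq pr qr by (simp add: E_commute)
  show False
    by (rule no_asteroidal_triple[OF I _ _ _ _ _ _ A _ _ _ B _ _ _ C])
      (simp_all add: E p q r sym V)
qed

text \<open>Private neighbours of the leaves, relative to the centre \<open>v\<close>, subdivide the
  claw; the ends of its legs form the asteroidal triple.\<close>

lemma no_claw_in_S:
  assumes I: "interval_model V E I" and S: "a \<in> S" "b \<in> S" "c \<in> S"
    and E: "E v a" "E v b" "E v c"
    and ne: "a \<noteq> b" "a \<noteq> c" "b \<noteq> c" "\<not> E a b" "\<not> E a c" "\<not> E b c"
  shows False
proof -
  have pend: "\<exists>p. E a p \<and> p \<noteq> v \<and> \<not> E p v" if "a \<in> S" "E v a" for a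
    using obtain_private_neighbour[of a v] that E_sym by metis
  obtain p q r where p: "E a p" "p \<noteq> v" "\<not> E p v" and q: "E b q" "q \<noteq> v" "\<not> E q v"
    and r: "E c r" "r \<noteq> v" "\<not> E r v"
    using pend S E by meson
  \<comment> \<open>An edge \<open>p b\<close> would close the four-cycle \<open>p b v a\<close>,
    and an edge \<open>p q\<close> the five-cycle \<open>p a v b q\<close>; both force the excluded
    edge \<open>p v\<close>.\<close>
  have far: "\<not> E p b \<and> p \<noteq> b \<and> p \<noteq> q \<and> \<not> E p q"
    if "E v a" "E v b" "a \<noteq> b" "\<not> E a b" "E a p" "p \<noteq> v" "\<not> E p v" "E b q" "q \<noteq> v" "\<not> E q v" for a b p q
  proof -
    have 1: "\<not> E p b" using four_cycle[of p b v a] that E_sym E_irrefl by blast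
    have 2: "p \<noteq> b" using that by blast
    have 3: "p \<noteq> q" using 1 that E_sym by blast
    have 4: "a \<noteq> q" using that E_sym by blast
    have "a \<noteq> v" "b \<noteq> v" using that E_irrefl by auto
    moreover have "p \<noteq> a" "q \<noteq> b" using that E_irrefl by auto
    ultimately have "distinct [p, a, v, b, q]" using that 2 3 4 by auto
    then have "\<not> E p q"
      using five_cycle[of p a v b q] that(1,2,5,7,8) E_sym by blast
    then show ?thesis using 1 2 3 by blast
  qed
  have ne': "\<not> E b a" "\<not> E c a" "\<not> E c b" using ne E_sym by blast+
  have F: "\<not> E p b" "p \<noteq> b" "p \<noteq> q" "\<not> E p q" "\<not> E q a" "q \<noteq> a" "\<not> E p c" "p \<noteq> c" "p \<noteq> r" "\<not> E p r"
    "\<not> E r a" "r \<noteq> a" "\<not> E q c" "q \<noteq> c" "q \<noteq> r" "\<not> E q r" "\<not> E r b" "r \<noteq> b"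
    using far[OF E(1,2) ne(1,4) p q] far[OF E(2,1) ne(1)[symmetric] ne'(1) q p]
      far[OF E(1,3) ne(2,5) p r] far[OF E(3,1) ne(2)[symmetric] ne'(2) r p]
      far[OF E(2,3) ne(3,6) q r] far[OF E(3,2) ne(3)[symmetric] ne'(3) r q]
    by simp_all
  note sym = E_sym[OF E(1)] E_sym[OF E(2)] E_sym[OF E(3)] E_sym[OF p(1)] E_sym[OF q(1)] E_sym[OF r(1)]
  note V = E_in_V[OF E(1)] E_in_V[OF p(1)] E_in_V[OF q(1)] E_in_V[OF r(1)]
    E_in_V[OF sym(4)] E_in_V[OF sym(5)] E_in_V[OF sym(6)]
  have A: "\<forall>u\<in>set [p,a,v,b,q]. u \<noteq> r \<and> \<not> E u r"
    using p q r F by (simp add: E_commute)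
  have B: "\<forall>u\<in>set [q,b,v,c,r]. u \<noteq> p \<and> \<not> E u p"
    using p q r F by (simp add: E_commute)
  have C: "\<forall>u\<in>set [p,a,v,c,r]. u \<noteq> q \<and> \<not> E u q"
    using p q r F by (simp add: E_commute)
  show False
    by (rule no_asteroidal_triple[OF I _ _ _ _ _ _ A _ _ _ B _ _ _ C])
      (simp_all add: E p q r sym V)
qed

section \<open>Paths of non-simplicial vertices\<close>

lemma no_long_chord:
  assumes I: "interval_model V E I" and xs: "distinct xs" "set xs \<subseteq> S" "successively E xs"
    and ij: "Suc i < j" "j < length xs"
  shows "\<not> E (xs ! i) (xs ! j)"
proof
  assume e: "E (xs ! i) (xs ! j)"
  \<comment> \<open>The chord closes the segment from index \<open>i\<close> to index
    \<open>j\<close>, both included, into a cycle. Since \<open>Suc i < j\<close> it has at least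
    three vertices, and the clique it spans contains a triangle in \<open>S\<close>.\<close>
  define ys where "ys = drop i (take (Suc j) xs)"
  have len: "length ys = Suc j - i" using ij by (simp add: ys_def)
  have nth: "ys ! k = xs ! (i + k)" if "k \<le> j - i" for k
    using that ij by (simp add: ys_def)
  have "ys \<noteq> []" using len ij by auto
  then have hl: "hd ys = xs ! i" "last ys = xs ! j"
    using ij nth[of 0] nth[of "j - i"] len by (auto simp: hd_conv_nth last_conv_nth Suc_diff_le)
  have succ: "successively E ys"
    using xs(3) ij by (auto simp: successively_conv_nth len nth)
  have d: "distinct ys" using xs(1) by (simp add: ys_def)
  have len3: "3 \<le> length ys" using len ij by simp
  have mem: "ys ! 0 \<in> set ys" "ys ! 1 \<in> set ys" "ys ! 2 \<in> set ys"
    using len3 by (auto intro!: nth_mem)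
  have ne: "ys ! 0 \<noteq> ys ! 1" "ys ! 1 \<noteq> ys ! 2" "ys ! 0 \<noteq> ys ! 2"
    using len3 nth_eq_iff_index_eq[OF d, of 0 1] nth_eq_iff_index_eq[OF d, of 1 2]
      nth_eq_iff_index_eq[OF d, of 0 2] \<open>ys \<noteq> []\<close> by simp_all
  have "E (last ys) (hd ys)" unfolding hl by (rule E_sym[OF e])
  note clq = cycle_clique[OF d len3 succ this]
  have "set ys \<subseteq> set xs"
    unfolding ys_def by (meson in_set_dropD in_set_takeD subsetI)
  then have "ys ! 0 \<in> S" "ys ! 1 \<in> S" "ys ! 2 \<in> S" using mem xs(2) by blast+
  then show False
    by (rule no_triangle_in_S[OF I _ _ _ clq[OF mem(1,2) ne(1)] clq[OF mem(2,3) ne(2)]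
        clq[OF mem(1,3) ne(3)]])
qed

text \<open>A longest path in \<open>S\<close> cannot be left along an edge within \<open>S\<close>,
  so connectedness makes it all of \<open>S\<close>; \<open>no_long_chord\<close> makes it
  induced.\<close>

lemma S_path_if_interval:
  assumes I: "interval_model V E I" and ne: "S \<noteq> {}"
  obtains xs where "xs \<noteq> []" "distinct xs" "set xs = S"
    "\<And>i j. \<lbrakk>i < length xs; j < length xs\<rbrakk> \<Longrightarrow> E (xs ! i) (xs ! j) \<longleftrightarrow> j = Suc i \<or> i = Suc j"
proof -
  define P where "P xs \<longleftrightarrow> distinct xs \<and> set xs \<subseteq> S \<and> successively E xs" for xs
  obtain s where s: "s \<in> S" using ne by blast
  have fin: "finite S" using finite_V by (simp add: S_def)
  have bound: "length xs < Suc (card S)" if "P xs" for xs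
    using that card_mono[OF fin] distinct_card unfolding P_def by (metis less_Suc_eq_le)
  have "P [s]" using s by (simp add: P_def)
  then obtain xs where xs: "P xs" and max: "\<And>ys. P ys \<Longrightarrow> length ys \<le> length xs"
    using ex_has_greatest_nat[of P "[s]" length "Suc (card S)"] bound by (metis less_imp_le)
  have "xs \<noteq> []" using max[OF \<open>P [s]\<close>] by auto
  \<comment> \<open>At an end of the path, \<open>y\<close> would extend it. At an inner vertex
    \<open>x\<close>, the path neighbours \<open>a\<close>, \<open>b\<close> and the vertex
    \<open>y\<close> are pairwise non-adjacent for lack of triangles, and form a claw centred at
    \<open>x\<close>.\<close>
  have closed: "y \<in> set xs" if x: "x \<in> set xs" and e: "E x y" and y: "y \<in> S" for x y
  proof (rule ccontr)
    assume nin: "y \<notin> set xs"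
    obtain i where i: "i < length xs" "x = xs ! i" using x by (metis in_set_conv_nth)
    have "i \<noteq> 0"
    proof
      assume "i = 0"
      then have "P (y # xs)"
        using xs nin y i e E_sym \<open>xs \<noteq> []\<close> by (auto simp: P_def successively_Cons hd_conv_nth)
      then show False using max by fastforce
    qed
    have "Suc i \<noteq> length xs"
    proof
      assume "Suc i = length xs"
      then have "last xs = x" using i \<open>xs \<noteq> []\<close> by (simp add: last_conv_nth flip: \<open>Suc i = length xs\<close>)
      then have "P (xs @ [y])"
        using xs nin y e \<open>xs \<noteq> []\<close> by (auto simp: P_def successively_append_iff)
      then show False using max by fastforce
    qed
    then have si: "Suc i < length xs" using i by simp
    define a b where "a = xs ! (i - 1)" and "b = xs ! Suc i"
    have ab: "a \<in> S" "b \<in> S" "x \<in> S" "a \<noteq> b" "a \<noteq> y" "b \<noteq> y"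
      using xs si i nin unfolding P_def a_def b_def
      by (auto simp: nth_eq_iff_index_eq subset_iff less_imp_diff_less)
    have "E x a" "E x b"
      using xs si i \<open>i \<noteq> 0\<close> successively_nth[of E xs "i - 1"] successively_nth[of E xs i] E_sym
      unfolding P_def a_def b_def by auto
    moreover have "\<not> E a b" "\<not> E a y" "\<not> E b y"
      using no_triangle_in_S[OF I] ab y e calculation by blast+
    ultimately show False
      using no_claw_in_S[OF I, of a b y x] ab y e by blast
  qed
  have "S \<subseteq> set xs"
  proof
    fix v assume "v \<in> S"
    have "hd xs \<in> set xs" using \<open>xs \<noteq> []\<close> by simp
    moreover have "hd xs \<in> S" using xs calculation by (auto simp: P_def)
    then have "(\<lambda>x y. E x y \<and> y \<in> S)\<^sup>*\<^sup>* (hd xs) v" using S_connected \<open>v \<in> S\<close> by blast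
    then show "v \<in> set xs"
      by (induction rule: rtranclp_induct) (use \<open>hd xs \<in> set xs\<close> closed in blast)+
  qed
  moreover have "E (xs ! i) (xs ! j) \<longleftrightarrow> j = Suc i \<or> i = Suc j"
    if "i < length xs" "j < length xs" for i j
  proof -
    have s: "E (xs ! k) (xs ! Suc k)" if "Suc k < length xs" for k
      using xs that successively_nth unfolding P_def by fast
    have l: "\<not> E (xs ! k) (xs ! l)" if "Suc k < l" "l < length xs" for k l
      using xs that no_long_chord[OF I] unfolding P_def by blast
    consider "i = j" | "j = Suc i" | "i = Suc j" | "Suc i < j" | "Suc j < i" by linarith
    then show ?thesis
    proof cases
      case 1 then show ?thesis using E_irrefl by simp
    next
      case 2 then show ?thesis using s[of i] that by simp
    next
      case 3 then show ?thesis using E_sym[OF s[of j]] that by simp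
    next
      case 4 then show ?thesis using l[of i j] that by simp
    next
      case 5 then show ?thesis using l[of j i] that E_sym by auto
    qed
  qed
  ultimately show thesis
    using that[of xs] xs \<open>xs \<noteq> []\<close> unfolding P_def by (meson subset_antisym)
qed

text \<open>The \<open>i\<close>-th vertex of the path receives \<open>[i, i + 1]\<close>.  A simplicial vertex adjacent to the
  \<open>i\<close>-th and the next vertex of the path receives the point \<open>i + 1\<close>; those adjacent to the \<open>i\<close>-th
  vertex only receive distinct points of the open interval.\<close>

lemma interval_if_S_path:
  assumes xs: "xs \<noteq> []" "distinct xs" "set xs = S"
    and path: "\<And>i j. \<lbrakk>i < length xs; j < length xs\<rbrakk> \<Longrightarrow>
      E (xs ! i) (xs ! j) \<longleftrightarrow> j = Suc i \<or> i = Suc j"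
  shows "\<exists>I. interval_model V E I"
proof -
  let ?T = "V - S"
  have simplicial_nbs: "E p q" if "v \<in> ?T" "E v p" "E v q" "p \<noteq> q" for v p q
    using that unfolding S_def by auto
  \<comment> \<open>Every other neighbour of \<open>u\<close> is adjacent to its neighbour
    \<open>v\<close>, and conversely, so adjacent simplicial vertices would be twins.\<close>
  have indep: "\<not> E u v" if "u \<in> ?T" "v \<in> ?T" for u v
  proof
    assume e: "E u v"
    have "u = w \<or> E u w \<longleftrightarrow> v = w \<or> E v w" for w
      using simplicial_nbs[of u v w] simplicial_nbs[of v u w] that e E_sym[OF e] by blast
    then have "u = v" using twin_free that by blast
    with e E_irrefl show False by blast
  qed
  \<comment> \<open>Distinct offsets for vertices attached to the same single path vertex. The 2 in
    the denominator keeps the values below 1 even where \<open>g v = 0\<close>.\<close>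
  obtain f :: "'b \<Rightarrow> real" where f: "inj_on f V" "\<And>v. 0 < f v \<and> f v < 1"
  proof -
    obtain g :: "'b \<Rightarrow> nat" where g: "inj_on g V"
      using finite_imp_inj_to_nat_seg[OF finite_V] by blast
    have "inj_on (\<lambda>v. 1 / (2 + real (g v))) V"
      using g by (auto simp: inj_on_def)
    then show thesis by (rule that) auto
  qed
  have E_S: "\<exists>i<length xs. E v (xs ! i)" if v: "v \<in> ?T" for v
  proof -
    obtain s where "s \<in> S" using xs by fastforce
    then have "\<exists>w\<in>S. w = v \<or> E w v" using reach_within_S[of s v] v by blast
    then obtain w where "w \<in> S" "E w v" using v by blast
    then obtain i where "i < length xs" "w = xs ! i" using xs(3) by (metis in_set_conv_nth)
    then show ?thesis using \<open>E w v\<close> E_sym by blast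
  qed
  define m where "m v = (LEAST i. i < length xs \<and> E v (xs ! i))" for v
  have m: "m v < length xs" "E v (xs ! m v)" if "v \<in> ?T" for v
    using LeastI_ex[OF E_S[OF that]] by (simp_all add: m_def)
  define two where "two v \<longleftrightarrow> Suc (m v) < length xs \<and> E v (xs ! Suc (m v))" for v
  \<comment> \<open>The path neighbours of a simplicial vertex are pairwise adjacent, so their
    indices differ by 1; after the least one, \<open>m v\<close>, only \<open>Suc (m v)\<close> is
    possible.\<close>
  have adj: "E v (xs ! i) \<longleftrightarrow> i = m v \<or> two v \<and> i = Suc (m v)" if v: "v \<in> ?T" and i: "i < length xs" for v i
  proof
    assume e: "E v (xs ! i)"
    show "i = m v \<or> two v \<and> i = Suc (m v)"
    proof (cases "i = m v")
      case False
      have "m v \<le> i" unfolding m_def using e i by (auto intro: Least_le)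
      have "xs ! i \<noteq> xs ! m v" using False m(1)[OF v] i xs(2) by (simp add: nth_eq_iff_index_eq)
      then have "E (xs ! m v) (xs ! i)" using simplicial_nbs[OF v m(2)[OF v] e] by simp
      then have "i = Suc (m v) \<or> m v = Suc i" using path[OF m(1)[OF v] i] by blast
      then have "i = Suc (m v)" using \<open>m v \<le> i\<close> by linarith
      then show ?thesis using e i unfolding two_def by fast
    qed simp
  next
    assume "i = m v \<or> two v \<and> i = Suc (m v)"
    then show "E v (xs ! i)" using m(2)[OF v] unfolding two_def by fast
  qed
  define pt where "pt v = real (m v) + (if two v then 1 else f v)" for v
  define idx where "idx v = (THE i. i < length xs \<and> xs ! i = v)" for v
  have idx: "idx (xs ! i) = i" if "i < length xs" for i
    unfolding idx_def using that xs(2) by (auto simp: nth_eq_iff_index_eq intro!: the_equality)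
  define I where "I v = (if v \<in> S then {real (idx v)..real (idx v) + 1} else {pt v})" for v
  have mixed: "E v s \<longleftrightarrow> I v \<inter> I s \<noteq> {}" if v: "v \<in> ?T" and s: "s \<in> S" for v s
  proof -
    obtain i where i: "i < length xs" "s = xs ! i" using s xs(3) by (metis in_set_conv_nth)
    have "E v s \<longleftrightarrow> i = m v \<or> two v \<and> i = Suc (m v)" using adj[OF v i(1)] i(2) by simp
    also have "\<dots> \<longleftrightarrow> real i \<le> pt v \<and> pt v \<le> real i + 1"
    proof (cases "two v")
      case True
      then show ?thesis unfolding pt_def by auto
    next
      case False
      have "i = m v" if "real i \<le> real (m v) + f v" "real (m v) + f v \<le> real i + 1"
      proof -
        have "real i < real (Suc (m v))" "real (m v) < real (Suc i)" using f(2)[of v] that by auto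
        then show ?thesis by linarith
      qed
      then show ?thesis using False f(2)[of v] unfolding pt_def by auto
    qed
    also have "\<dots> \<longleftrightarrow> I v \<inter> I s \<noteq> {}" using v s idx[OF i(1)] i(2) by (auto simp: I_def)
    finally show ?thesis .
  qed
  have SS: "E s t \<longleftrightarrow> I s \<inter> I t \<noteq> {}" if s: "s \<in> S" "t \<in> S" "s \<noteq> t" for s t
  proof -
    obtain i where i: "i < length xs" "s = xs ! i" using s xs(3) by (metis in_set_conv_nth)
    obtain j where j: "j < length xs" "t = xs ! j" using s xs(3) by (metis in_set_conv_nth)
    have "i \<noteq> j" using i j s by blast
    have "E s t \<longleftrightarrow> j = Suc i \<or> i = Suc j" using path i j by simp
    also have "\<dots> \<longleftrightarrow> real i \<le> real j + 1 \<and> real j \<le> real i + 1" using \<open>i \<noteq> j\<close> by auto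
    also have "\<dots> \<longleftrightarrow> I s \<inter> I t \<noteq> {}"
      using s idx[OF i(1)] idx[OF j(1)] i(2) j(2) by (auto simp: I_def)
    finally show ?thesis .
  qed
  \<comment> \<open>The offsets \<open>f\<close> are non-integral and distinct, so equal points are
    integral and have the same \<open>m\<close>. Then \<open>u\<close> and \<open>v\<close> share
    two path vertices, and the resulting four-cycle makes them adjacent.\<close>
  have TT: "pt u \<noteq> pt v" if uv: "u \<in> ?T" "v \<in> ?T" "u \<noteq> v" for u v
  proof
    assume eq: "pt u = pt v"
    have fne: "f u \<noteq> f v" using f(1) uv by (auto simp: inj_on_def)
    have "m u = m v \<and> two u \<and> two v"
    proof (cases "two u"; cases "two v")
      assume "two u" "two v"
      then show ?thesis using eq by (simp add: pt_def)
    next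
      assume "two u" "\<not> two v"
      then have "real (m v) < real (Suc (m u))" "real (Suc (m u)) < real (Suc (m v))"
        using eq f(2)[of v] by (auto simp: pt_def)
      then have False unfolding of_nat_less_iff by linarith
      then show ?thesis ..
    next
      assume "\<not> two u" "two v"
      then have "real (m u) < real (Suc (m v))" "real (Suc (m v)) < real (Suc (m u))"
        using eq f(2)[of u] by (auto simp: pt_def)
      then have False unfolding of_nat_less_iff by linarith
      then show ?thesis ..
    next
      assume nt: "\<not> two u" "\<not> two v"
      then have "real (m u) < real (Suc (m v))" "real (m v) < real (Suc (m u))"
        using eq f(2)[of u] f(2)[of v] by (auto simp: pt_def)
      then have "m u = m v" by linarith
      then show ?thesis using eq fne nt by (simp add: pt_def)
    qed
    then have "E u (xs ! m u)" "E u (xs ! Suc (m u))" "E v (xs ! m u)" "E v (xs ! Suc (m u))"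
      "xs ! m u \<noteq> xs ! Suc (m u)"
      using m[of u] m[of v] uv xs(2) unfolding two_def by (metis nth_eq_iff_index_eq n_not_Suc_n)+
    then have "E u v" using four_cycle[of u "xs ! m u" v "xs ! Suc (m u)"] uv E_sym by blast
    with indep uv show False by blast
  qed
  have "interval_model V E I"
    unfolding interval_model_def
  proof (intro conjI ballI impI)
    fix v assume "v \<in> V"
    then show "is_interval (I v)" "I v \<noteq> {}" by (auto simp: I_def is_interval_1)
  next
    fix u v assume uv: "u \<in> V" "v \<in> V" "u \<noteq> v"
    consider "u \<in> S" "v \<in> S" | "u \<in> ?T" "v \<in> S" | "u \<in> S" "v \<in> ?T" | "u \<in> ?T" "v \<in> ?T"
      using uv by blast
    then show "E u v \<longleftrightarrow> I u \<inter> I v \<noteq> {}"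
    proof cases
      case 1 then show ?thesis using SS uv by blast
    next
      case 2 then show ?thesis using mixed by blast
    next
      case 3 then show ?thesis using mixed[of v u] E_sym by blast
    next
      case 4 then show ?thesis using TT[of u v] indep[of u v] uv by (auto simp: I_def)
    qed
  qed
  then show ?thesis by blast
qed

end

section \<open>Cycles in block graphs\<close>

lemma dominates_induce_subgraph_iff:
  "u \<rightarrow>\<^bsub>G \<restriction> U\<^esub> v \<longleftrightarrow> u \<in> U \<and> v \<in> U \<and> u \<rightarrow>\<^bsub>G\<^esub> v"
  by (auto simp: arcs_ends_conv)

lemma dominates_del_vert_iff:
  "u \<rightarrow>\<^bsub>pre_digraph.del_vert G w\<^esub> v \<longleftrightarrow> u \<noteq> w \<and> v \<noteq> w \<and> u \<rightarrow>\<^bsub>G\<^esub> v"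
  by (auto simp: arcs_ends_conv pre_digraph.del_vert_def)

lemma (in graph) graph_induce_subgraph:
  assumes "U \<subseteq> verts G"
  shows "graph (G \<restriction> U)"
proof -
  have "symmetric (G \<restriction> U)"
    using induced_graph_imp_symmetric[OF sym_arcs induced_induce[OF assms]] .
  then show ?thesis
    using no_loops no_multi_arcs finite_subset[OF assms finite_verts]
    by unfold_locales auto
qed

text \<open>The head of the walk reaches every vertex and, by symmetry, is reached from it.
  Connectedness refers to the symmetric closure, which changes no reachability here.\<close>

lemma (in wf_digraph) connected_if_spanning_walk:
  assumes "symmetric G" "successively (dominates G) us" "set us = verts G" "us \<noteq> []"
  shows "Digraph_Component.connected G"
proof -
  have "\<forall>v\<in>set us. hd us \<rightarrow>\<^sup>* v" if "successively (dominates G) us" "set us \<subseteq> verts G" for us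
    using that
  proof (induction us rule: induct_list012)
    case (3 x y zs)
    then have "x \<rightarrow> y" "\<forall>v\<in>set (y # zs). y \<rightarrow>\<^sup>* v" "x \<in> verts G" by auto
    then show ?case using adj_reachable_trans by auto
  qed auto
  then have hd: "\<forall>v\<in>verts G. hd us \<rightarrow>\<^sup>* v" using assms by blast
  have "strongly_connected G"
  proof
    show "verts G \<noteq> {}" using assms by force
    fix u v assume "u \<in> verts G" "v \<in> verts G"
    then show "u \<rightarrow>\<^sup>* v"
      using hd symmetric_reachable[OF assms(1)] reachable_trans by blast
  qed
  moreover have "verts (mk_symmetric G) = verts G" by (simp add: mk_symmetric_def)
  ultimately show ?thesis
    unfolding Digraph_Component.connected_def strongly_connected_def
      reachable_mk_symmetric_eq[OF assms(1)] by simp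
qed

lemma (in wf_digraph) closed_walk_subset_verts:
  assumes "successively (dominates G) xs" "last xs \<rightarrow> hd xs"
  shows "set xs \<subseteq> verts G"
proof -
  have "set xs \<subseteq> verts G" if "successively (dominates G) xs" "xs \<noteq> []" "last xs \<in> verts G" for xs
    using that by (induction xs rule: induct_list012) (auto intro: adj_in_verts)
  then show ?thesis using assms adj_in_verts(1) by (cases "xs = []") auto
qed

lemma (in graph) two_connected_cycle:
  assumes d: "distinct xs" and len: "3 \<le> length xs"
    and walk: "successively (dominates G) xs" and close: "last xs \<rightarrow> hd xs"
  shows "two_connected (G \<restriction> set xs)"
proof -
  have sub: "set xs \<subseteq> verts G" by (rule closed_walk_subset_verts[OF walk close])
  interpret C: graph "G \<restriction> set xs" by (rule graph_induce_subgraph[OF sub])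
  have "successively (dominates (G \<restriction> set xs)) xs"
    using walk by (rule successively_mono) (simp add: dominates_induce_subgraph_iff)
  then have conn: "Digraph_Component.connected (G \<restriction> set xs)"
    using C.connected_if_spanning_walk C.sym_arcs len by fastforce
  have "Digraph_Component.connected (pre_digraph.del_vert (G \<restriction> set xs) v)" if v: "v \<in> set xs" for v
  proof -
    obtain as bs where ab: "xs = as @ v # bs" using v by (meson split_list)
    let ?D = "pre_digraph.del_vert (G \<restriction> set xs) v"
    interpret D: wf_digraph ?D by (rule C.wf_digraph_del_vert)
    have "symmetric ?D"
      using graph_symmetric unfolding symmetric_def sym_def
      by (simp add: dominates_del_vert_iff dominates_induce_subgraph_iff)
    \<comment> \<open>Cutting the cycle at \<open>v\<close> leaves one walk: from the vertex after
      \<open>v\<close> to the end of the list, over the closing edge, and on to the vertex before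
      \<open>v\<close>.\<close>
    moreover have "successively (dominates G) (bs @ as)"
      using walk close unfolding ab
      by (cases "as = []"; cases "bs = []") (auto simp: successively_append_iff successively_Cons)
    then have "successively (dominates ?D) (bs @ as)"
      by (rule successively_mono)
        (use d ab in \<open>auto simp: dominates_del_vert_iff dominates_induce_subgraph_iff\<close>)
    moreover have "set (bs @ as) = verts ?D"
      using d unfolding ab by (auto simp: pre_digraph.del_vert_def)
    moreover have "bs @ as \<noteq> []" using len unfolding ab by auto
    ultimately show ?thesis by (rule D.connected_if_spanning_walk)
  qed
  then show ?thesis
    using conn C.graph_axioms len distinct_card[OF d] by (simp add: two_connected_def)
qed

text \<open>Among the two-connected subgraphs whose vertices include those of \<open>C\<close>, one
  with the most vertices and arcs is maximal. Arcs are counted too because a larger subgraph may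
  have the same vertices.\<close>

lemma (in graph) two_connected_max_subgraph:
  assumes "subgraph C G" "two_connected C"
  obtains B where "max_subgraph two_connected B" "verts C \<subseteq> verts B"
proof -
  define P where "P B \<longleftrightarrow> subgraph B G \<and> two_connected B \<and> verts C \<subseteq> verts B" for B
  define f where "f B = card (verts B) + card (arcs B)" for B :: "('a, 'b) pre_digraph"
  have mono: "f B \<le> f B'" "f B = f B' \<Longrightarrow> B = B'" if "subgraph B B'" "subgraph B' G" for B B'
  proof -
    have fin: "finite (verts B')" "finite (arcs B')"
      using that(2) finite_verts finite_arcs by (meson finite_subset subgraphE)+
    have ss: "verts B \<subseteq> verts B'" "arcs B \<subseteq> arcs B'" "compatible B' B" using that(1) by auto
    have le: "card (verts B) \<le> card (verts B')" "card (arcs B) \<le> card (arcs B')"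
      using ss fin by (auto intro: card_mono)
    then show "f B \<le> f B'" by (simp add: f_def)
    assume "f B = f B'"
    then have "card (verts B) = card (verts B')" "card (arcs B) = card (arcs B')"
      using le by (auto simp: f_def)
    then have "verts B = verts B'" "arcs B = arcs B'" using ss fin by (simp_all add: card_subset_eq)
    then show "B = B'" using ss(3) by (intro pre_digraph.equality) (auto simp: compatible_def)
  qed
  have "P C" using assms by (simp add: P_def)
  moreover have "f B \<le> f G" if "P B" for B
    using mono(1)[of B G] that subgraph_refl by (simp add: P_def)
  ultimately obtain B where B: "P B" "\<And>B'. P B' \<Longrightarrow> f B' \<le> f B"
    using ex_has_greatest_nat[of P C f "Suc (f G)"] by (metis less_Suc_eq_le le_SucI)
  have "\<not> two_connected B'" if B': "B' \<noteq> B" "subgraph B B'" "subgraph B' G" for B'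
  proof
    assume "two_connected B'"
    then have "P B'" using B B' unfolding P_def by blast
    then have "f B = f B'" using B(2) mono(1)[OF B'(2,3)] by (simp add: le_antisym)
    then show False using mono(2)[OF B'(2,3)] B'(1) by blast
  qed
  then have "max_subgraph two_connected B"
    using B(1) unfolding max_subgraph_def P_def by blast
  with B show thesis using that unfolding P_def by blast
qed

lemma block_graph_cycle_clique:
  assumes "block_graph G" "distinct xs" "3 \<le> length xs" "successively (dominates G) xs"
    "last xs \<rightarrow>\<^bsub>G\<^esub> hd xs" "u \<in> set xs" "v \<in> set xs" "u \<noteq> v"
  shows "u \<rightarrow>\<^bsub>G\<^esub> v"
proof -
  interpret graph G using assms by (simp add: block_graph_def)
  have tc: "two_connected (G \<restriction> set xs)" using assms by (intro two_connected_cycle)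
  have "set xs \<subseteq> verts G" using assms by (intro closed_walk_subset_verts)
  then have "subgraph (G \<restriction> set xs) G" by (intro induced_imp_subgraph induced_induce)
  then obtain B where B: "max_subgraph two_connected B" "verts (G \<restriction> set xs) \<subseteq> verts B"
    using two_connected_max_subgraph tc by blast
  then have "complete_graph B" using assms(1) by (simp add: block_graph_def block_def)
  then have "u \<rightarrow>\<^bsub>B\<^esub> v" using B(2) assms by (auto simp: complete_graph_def complete_digraph_def)
  moreover have "subgraph B G" using B(1) by (rule subgraphI_max_subgraph)
  ultimately show ?thesis by (auto simp: arcs_ends_conv compatible_def elim!: subgraphE)
qed

section \<open>The critical clique graph\<close>

context graph
begin

lemma twin_adj:
  assumes "true_twins G u v" "u \<noteq> v"
  shows "u \<rightarrow> v"
proof -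
  have "v \<in> closed_nbhd G u" using assms(1) by (simp add: true_twins_def closed_nbhd_def)
  then show ?thesis using assms(2) by (simp add: closed_nbhd_def nbhd_def)
qed

text \<open>The endpoints are exchanged one at a time through closed neighbourhoods. As
  \<open>u\<close> and \<open>v\<close> are not twins, the endpoints never coincide, so membership
  there gives an edge.\<close>

lemma adj_twins_cong:
  assumes "true_twins G u u'" "true_twins G v v'" "\<not> true_twins G u v" "u \<rightarrow> v"
  shows "u' \<rightarrow> v'"
proof -
  have "v \<in> closed_nbhd G u'"
    using assms(1,4) adj_in_verts by (auto simp: true_twins_def closed_nbhd_def nbhd_def)
  moreover have "v \<noteq> u'" using assms(1,3) by auto
  ultimately have "v \<rightarrow> u'" using graph_symmetric by (simp add: closed_nbhd_def nbhd_def)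
  then have "u' \<in> closed_nbhd G v'"
    using assms(2) adj_in_verts by (auto simp: true_twins_def closed_nbhd_def nbhd_def)
  moreover have "u' \<noteq> v'" using assms(1-3) by (auto simp: true_twins_def)
  ultimately show ?thesis using graph_symmetric by (simp add: closed_nbhd_def nbhd_def)
qed

text \<open>Being true twins is an equivalence relation, and its classes turn out to be the critical
  cliques. Maximality thus gives way to a class named by any member.\<close>

definition twin_class :: "'a \<Rightarrow> 'a set" where
  "twin_class u = {v \<in> verts G. true_twins G u v}"

lemma critical_clique_subset: "critical_clique G Q \<Longrightarrow> u \<in> Q \<Longrightarrow> u \<in> verts G"
  by (auto simp: critical_clique_def)

lemma self_in_twin_class: "u \<in> verts G \<Longrightarrow> u \<in> twin_class u"
  by (simp add: twin_class_def true_twins_def)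

lemma pairwise_twins_subset_twin_class:
  assumes "pairwise (true_twins G) Q" "Q \<subseteq> verts G" "u \<in> Q"
  shows "Q \<subseteq> twin_class u"
proof
  fix w assume "w \<in> Q"
  then have "w = u \<or> true_twins G u w" using assms(1,3) pairwiseD by metis
  then show "w \<in> twin_class u"
    using \<open>w \<in> Q\<close> assms(2) by (auto simp: twin_class_def true_twins_def)
qed

lemma critical_clique_twin_class:
  assumes "u \<in> verts G"
  shows "critical_clique G (twin_class u)"
proof -
  have "pairwise (true_twins G) (twin_class u)"
    by (auto simp: pairwise_def twin_class_def true_twins_def)
  moreover have "twin_class u \<subseteq> verts G" by (auto simp: twin_class_def)
  ultimately show ?thesis
    using self_in_twin_class[OF assms] pairwise_twins_subset_twin_class
    unfolding critical_clique_def by blast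
qed

lemma critical_clique_eq_twin_class:
  assumes "critical_clique G Q" "u \<in> Q"
  shows "Q = twin_class u"
proof -
  have "u \<in> verts G" using assms by (rule critical_clique_subset)
  moreover have "Q \<subseteq> twin_class u"
    using assms pairwise_twins_subset_twin_class by (simp add: critical_clique_def)
  ultimately show ?thesis
    using assms(1) critical_clique_twin_class unfolding critical_clique_def by blast
qed

lemma critical_clique_eq_iff:
  assumes "critical_clique G Q" "critical_clique G R" "u \<in> Q" "v \<in> R"
  shows "Q = R \<longleftrightarrow> true_twins G u v"
proof -
  have "v \<in> verts G" using assms critical_clique_subset by blast
  then show ?thesis
    using critical_clique_eq_twin_class[OF assms(1,3)] critical_clique_eq_twin_class[OF assms(2,4)]
    by (auto simp: twin_class_def true_twins_def)
qed

text \<open>Lets adjacency be read off at arbitrary representatives: by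
  \<open>adj_twins_cong\<close>, one edge between two classes yields all of them.\<close>

lemma critical_clique_graph_adj_iff:
  assumes "critical_clique G Q" "critical_clique G R" "u \<in> Q" "v \<in> R"
  shows "(Q, R) \<in> parcs (critical_clique_graph G) \<longleftrightarrow> Q \<noteq> R \<and> u \<rightarrow> v"
proof
  assume "(Q, R) \<in> parcs (critical_clique_graph G)"
  then obtain u' v' where *: "Q \<noteq> R" "u' \<in> Q" "v' \<in> R" "u' \<rightarrow> v'"
    by (auto simp: critical_clique_graph_def)
  then show "Q \<noteq> R \<and> u \<rightarrow> v"
    using adj_twins_cong[of u' u v' v] critical_clique_eq_iff assms by blast
qed (use assms in \<open>auto simp: critical_clique_graph_def\<close>)

section \<open>\<open>CC(G)\<close> as a connected graph without true twins\<close>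

abbreviation "K \<equiv> critical_clique_graph G"

lemma pair_graph_critical_clique_graph: "pair_graph K"
proof -
  have "finite {Q. critical_clique G Q}"
    by (rule finite_subset[of _ "Pow (verts G)"]) (auto simp: critical_clique_def)
  moreover have "parcs K \<subseteq> {Q. critical_clique G Q} \<times> {Q. critical_clique G Q}"
    by (auto simp: critical_clique_graph_def)
  moreover have "pverts K = {Q. critical_clique G Q}" by (simp add: critical_clique_graph_def)
  ultimately have "finite (pverts K)" "finite (parcs K)"
    using finite_subset finite_cartesian_product by metis+
  moreover have "(R, Q) \<in> parcs K" if "(Q, R) \<in> parcs K" for Q R
    using that graph_symmetric unfolding critical_clique_graph_def by fastforce
  then have "symmetric (with_proj K)" by (simp add: symmetric_def sym_def)
  ultimately show ?thesis
    by unfold_locales (auto simp: critical_clique_graph_def)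
qed

text \<open>A closed neighbourhood in \<open>G\<close> is the union of the cliques in a closed
  neighbourhood of \<open>CC(G)\<close>. Twin cliques therefore have members that are twins, and
  coincide.\<close>

lemma twin_free_critical_clique_graph:
  assumes "Q \<in> pverts K" "R \<in> pverts K"
    and nb: "\<And>P. Q = P \<or> (Q, P) \<in> parcs K \<longleftrightarrow> R = P \<or> (R, P) \<in> parcs K"
  shows "Q = R"
proof -
  have crit: "critical_clique G Q" "critical_clique G R"
    using assms by (auto simp: critical_clique_graph_def)
  then obtain u v where uv: "u \<in> Q" "v \<in> R" by (auto simp: critical_clique_def)
  have closed: "w \<in> closed_nbhd G u' \<longleftrightarrow> w \<in> verts G \<and> (Q' = twin_class w \<or> (Q', twin_class w) \<in> parcs K)"
    if "critical_clique G Q'" "u' \<in> Q'" for w u' Q'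
  proof (cases "w \<in> verts G")
    case True
    have w: "critical_clique G (twin_class w)" "w \<in> twin_class w"
      using True critical_clique_twin_class by (auto simp: twin_class_def true_twins_def)
    have "u' \<in> verts G" using that critical_clique_subset by blast
    then show ?thesis
      using critical_clique_graph_adj_iff[OF that(1) w(1) that(2) w(2)]
        critical_clique_eq_iff[OF that(1) w(1) that(2) w(2)] True twin_adj[of u' w]
      by (auto simp: closed_nbhd_def nbhd_def true_twins_def)
  next
    case False
    then show ?thesis using that critical_clique_subset by (auto simp: closed_nbhd_def nbhd_def)
  qed
  have "closed_nbhd G u = closed_nbhd G v"
    using closed[OF crit(1) uv(1)] closed[OF crit(2) uv(2)] nb by blast
  then show ?thesis using critical_clique_eq_iff[OF crit uv] by (simp add: true_twins_def)
qed

text \<open>A walk in \<open>G\<close> projects to a walk of twin classes, where an edge between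
  twins becomes a repetition.\<close>

lemma connected_critical_clique_graph:
  assumes "Digraph_Component.connected G" "Q \<in> pverts K" "R \<in> pverts K"
  shows "(\<lambda>Q R. (Q, R) \<in> parcs K)\<^sup>*\<^sup>* Q R"
proof -
  have crit: "critical_clique G Q" "critical_clique G R"
    using assms by (auto simp: critical_clique_graph_def)
  then obtain u v where uv: "u \<in> Q" "v \<in> R" by (auto simp: critical_clique_def)
  have "strongly_connected G" by (rule symmetric_connected_imp_strongly_connected[OF sym_arcs assms(1)])
  then have "u \<rightarrow>\<^sup>* v" using uv crit critical_clique_subset by blast
  then have "(\<lambda>Q R. (Q, R) \<in> parcs K)\<^sup>*\<^sup>* (twin_class u) (twin_class v)"
  proof (induction rule: reachable_induct)
    case (step x y)
    have xy: "x \<in> verts G" "y \<in> verts G" using step adj_in_verts by auto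
    have "twin_class x = twin_class y \<or> (twin_class x, twin_class y) \<in> parcs K"
      using critical_clique_graph_adj_iff[of "twin_class x" "twin_class y" x y]
        critical_clique_twin_class step.hyps(2) xy
      by (auto simp: twin_class_def true_twins_def)
    with step.IH show ?case by (metis (no_types, lifting) rtranclp.rtrancl_into_rtrancl)
  qed simp
  then show ?thesis
    using critical_clique_eq_twin_class[OF crit(1) uv(1)] critical_clique_eq_twin_class[OF crit(2) uv(2)]
    by simp
qed

section \<open>Interval models of \<open>G\<close> and of \<open>CC(G)\<close>\<close>

lemma interval_model_critical_clique_graph:
  assumes "interval_graph G"
  obtains J where "interval_model (pverts K) (\<lambda>Q R. (Q, R) \<in> parcs K) J"
proof -
  obtain I :: "'a \<Rightarrow> real set" where model: "interval_model (verts G) (dominates G) I"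
    using assms by (auto simp: interval_graph_def interval_model_def)
  then have I: "\<forall>v\<in>verts G. is_interval (I v) \<and> I v \<noteq> {}"
    "\<forall>u\<in>verts G. \<forall>v\<in>verts G. u \<noteq> v \<longrightarrow> (u \<rightarrow> v \<longleftrightarrow> I u \<inter> I v \<noteq> {})"
    by (simp_all add: interval_model_def)
  \<comment> \<open>One representative per critical clique: these span a copy of
    \<open>CC(G)\<close> inside \<open>G\<close>, and their intervals are inherited.\<close>
  define r where "r Q = (SOME u. u \<in> Q)" for Q :: "'a set"
  have r: "r Q \<in> Q" "r Q \<in> verts G" "critical_clique G Q" if "Q \<in> pverts K" for Q
  proof -
    show crit: "critical_clique G Q" using that by (simp add: critical_clique_graph_def)
    then have "Q \<noteq> {}" by (simp add: critical_clique_def)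
    then show "r Q \<in> Q" unfolding r_def by (simp add: some_in_eq)
    then show "r Q \<in> verts G" by (rule critical_clique_subset[OF crit])
  qed
  have "(Q, R) \<in> parcs K \<longleftrightarrow> I (r Q) \<inter> I (r R) \<noteq> {}"
    if QR: "Q \<in> pverts K" "R \<in> pverts K" "Q \<noteq> R" for Q R
  proof -
    have "twin_class (r Q) = Q" "twin_class (r R) = R"
      using critical_clique_eq_twin_class r QR(1,2) by blast+
    with QR(3) have "r Q \<noteq> r R" by metis
    then have "r Q \<rightarrow> r R \<longleftrightarrow> I (r Q) \<inter> I (r R) \<noteq> {}"
      using I(2) r(2) QR(1,2) by simp
    then show ?thesis
      using critical_clique_graph_adj_iff[OF r(3)[OF QR(1)] r(3)[OF QR(2)] r(1)[OF QR(1)] r(1)[OF QR(2)]]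
        QR(3) by simp
  qed
  with I(1) r(2) have "interval_model (pverts K) (\<lambda>Q R. (Q, R) \<in> parcs K) (I \<circ> r)"
    by (simp add: interval_model_def)
  then show thesis by (rule that)
qed

text \<open>Every vertex takes the interval of its class. Twins then share a nonempty interval, as
  they must, being adjacent.\<close>

lemma interval_graph_if_critical_clique_graph_model:
  assumes model: "interval_model (pverts K) (\<lambda>Q R. (Q, R) \<in> parcs K) I"
  shows "interval_graph G"
proof -
  have I: "\<forall>Q\<in>pverts K. is_interval (I Q) \<and> I Q \<noteq> {}"
    "\<forall>Q\<in>pverts K. \<forall>R\<in>pverts K. Q \<noteq> R \<longrightarrow> ((Q, R) \<in> parcs K \<longleftrightarrow> I Q \<inter> I R \<noteq> {})"
    using model by (simp_all add: interval_model_def)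
  have c: "twin_class u \<in> pverts K" "critical_clique G (twin_class u)" "u \<in> twin_class u"
    if "u \<in> verts G" for u
    using critical_clique_twin_class[OF that] self_in_twin_class[OF that]
    by (simp_all add: critical_clique_graph_def)
  have "u \<rightarrow> v \<longleftrightarrow> I (twin_class u) \<inter> I (twin_class v) \<noteq> {}"
    if uv: "u \<in> verts G" "v \<in> verts G" "u \<noteq> v" for u v
  proof (cases "twin_class u = twin_class v")
    case True
    then have "u \<rightarrow> v"
      using critical_clique_eq_iff[OF c(2)[OF uv(1)] c(2)[OF uv(2)] c(3)[OF uv(1)] c(3)[OF uv(2)]]
        True twin_adj uv(3) by simp
    then show ?thesis using True I(1) c(1)[OF uv(2)] by simp
  next
    case False
    then show ?thesis
      using critical_clique_graph_adj_iff[OF c(2)[OF uv(1)] c(2)[OF uv(2)] c(3)[OF uv(1)] c(3)[OF uv(2)]]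
        False I(2) c(1)[OF uv(1)] c(1)[OF uv(2)] by simp
  qed
  with I(1) c(1) have "interval_model (verts G) (dominates G) (I \<circ> twin_class)"
    by (simp add: interval_model_def)
  then show "interval_graph G"
    using graph_axioms unfolding interval_graph_def interval_model_def by (intro conjI exI[of _ "I \<circ> twin_class"]) simp_all
qed

text \<open>Contrapositively, a graph that is not complete has two distinct critical cliques; this
  is how non-completeness enters.\<close>

lemma complete_if_all_twins:
  assumes "\<And>u v. u \<in> verts G \<Longrightarrow> v \<in> verts G \<Longrightarrow> true_twins G u v"
  shows "complete_graph G"
proof -
  have "u \<rightarrow> v \<longleftrightarrow> u \<in> verts G \<and> v \<in> verts G \<and> u \<noteq> v" for u v
    using assms twin_adj adj_in_verts adj_not_same by metis
  then have "arcs_ends G = {(u, v). (u, v) \<in> verts G \<times> verts G \<and> u \<noteq> v}" by auto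
  then show ?thesis unfolding complete_graph_def complete_digraph_def using graph_axioms by simp
qed

end

section \<open>Adding true twins to the vertices of a graph\<close>

lemma graph_with_proj:
  assumes "pair_graph G"
  shows "graph (with_proj G)"
proof -
  interpret pair_graph G by fact
  show ?thesis by unfold_locales
qed

text \<open>Added twins are new vertices, so a vertex \<open>z\<close> of \<open>H\<close> lies in
  \<open>insert x (T x)\<close> only for \<open>x = z\<close>.\<close>

lemma parcs_add_true_twins_base_iff:
  assumes T: "\<forall>x\<in>pverts H. T x \<inter> pverts H = {}"
    and "x \<in> pverts H" "y \<in> pverts H" "x \<noteq> y"
  shows "(x, y) \<in> parcs (add_true_twins H T) \<longleftrightarrow> (x, y) \<in> parcs H"
proof -
  have "x' = z" if "x' \<in> pverts H" "z \<in> pverts H" "z \<in> insert x' (T x')" for x' z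
    using T that by blast
  then show ?thesis
    using assms(2-4) unfolding add_true_twins_def by auto
qed

text \<open>The sets \<open>insert y (T y)\<close> are disjoint, so each vertex determines its
  \<open>x\<close>. Its closed neighbourhood is the union of these sets over \<open>x\<close> and
  the neighbours of \<open>x\<close> in \<open>H\<close>, which depends on \<open>x\<close>
  alone.\<close>

lemma true_twin_in_base:
  assumes T: "\<forall>x\<in>pverts H. T x \<inter> pverts H = {}" "disjoint_family_on T (pverts H)"
    and u: "u \<in> pverts (add_true_twins H T)"
  obtains x where "x \<in> pverts H" "x \<in> pverts (add_true_twins H T)"
    "true_twins (with_proj (add_true_twins H T)) u x"
proof -
  let ?G = "add_true_twins H T"
  obtain x where x: "x \<in> pverts H" "u \<in> insert x (T x)"
    using u by (auto simp: add_true_twins_def)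
  have uniq: "y = z" if "y \<in> pverts H" "z \<in> pverts H" "w \<in> insert y (T y)" "w \<in> insert z (T z)" for w y z
    using T that unfolding disjoint_family_on_def by blast
  have closed: "closed_nbhd (with_proj ?G) w = {v. \<exists>y\<in>pverts H. v \<in> insert y (T y) \<and> (x = y \<or> (x, y) \<in> parcs H)}"
    if w: "w \<in> insert x (T x)" for w
  proof (intro set_eqI)
    fix v
    have mem: "v \<in> pverts ?G \<longleftrightarrow> (\<exists>y\<in>pverts H. v \<in> insert y (T y))"
      by (simp add: add_true_twins_def)
    have arc: "(w, v) \<in> parcs ?G \<longleftrightarrow> w \<noteq> v \<and> (\<exists>y\<in>pverts H. v \<in> insert y (T y) \<and> (x = y \<or> (x, y) \<in> parcs H))"
    proof
      assume "(w, v) \<in> parcs ?G"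
      then obtain x' y where *: "w \<noteq> v" "x' \<in> pverts H" "y \<in> pverts H" "w \<in> insert x' (T x')"
        "v \<in> insert y (T y)" "x' = y \<or> (x', y) \<in> parcs H"
        unfolding add_true_twins_def by auto
      then have "x' = x" using uniq[OF _ x(1) _ w] by simp
      with * show "w \<noteq> v \<and> (\<exists>y\<in>pverts H. v \<in> insert y (T y) \<and> (x = y \<or> (x, y) \<in> parcs H))"
        by fast
    next
      assume "w \<noteq> v \<and> (\<exists>y\<in>pverts H. v \<in> insert y (T y) \<and> (x = y \<or> (x, y) \<in> parcs H))"
      with x(1) w show "(w, v) \<in> parcs ?G" unfolding add_true_twins_def by fastforce
    qed
    show "v \<in> closed_nbhd (with_proj ?G) w \<longleftrightarrow>
        v \<in> {v. \<exists>y\<in>pverts H. v \<in> insert y (T y) \<and> (x = y \<or> (x, y) \<in> parcs H)}"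
    proof (cases "v = w")
      case True
      then show ?thesis using w x(1) by (auto simp: closed_nbhd_def)
    next
      case False
      then show ?thesis using mem arc by (auto simp: closed_nbhd_def nbhd_def)
    qed
  qed
  have "true_twins (with_proj ?G) u x"
    using closed[OF x(2)] closed[of x] by (simp add: true_twins_def)
  moreover have "x \<in> pverts ?G" using x(1) by (auto simp: add_true_twins_def)
  ultimately show thesis using that x(1) by blast
qed

lemma clique_cycle_graph_critical_cliques:
  assumes G: "pair_graph G" "Digraph_Component.connected (with_proj G)" "strictly_chordal G"
  shows "clique_cycle_graph (pverts (critical_clique_graph (with_proj G)))
    (\<lambda>Q R. (Q, R) \<in> parcs (critical_clique_graph (with_proj G)))"
proof -
  interpret graph "with_proj G" by (rule graph_with_proj[OF assms(1)])
  let ?K = "critical_clique_graph (with_proj G)"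
  interpret K: graph "with_proj ?K" by (rule graph_with_proj[OF pair_graph_critical_clique_graph])
  have K_adj: "Q \<in> pverts ?K" "(R, Q) \<in> parcs ?K" "Q \<noteq> R" if "(Q, R) \<in> parcs ?K" for Q R
    using that K.adj_in_verts(1)[of Q R] K.graph_symmetric[of Q R] K.adj_not_same[of Q] by auto
  obtain H T where H: "block_graph (with_proj H)"
    and T: "\<forall>x\<in>pverts H. T x \<inter> pverts H = {}" "disjoint_family_on T (pverts H)"
    and G_eq: "G = add_true_twins H T"
    using G(3) unfolding strictly_chordal_def by blast
  have crit: "critical_clique (with_proj G) Q \<longleftrightarrow> Q \<in> pverts ?K" for Q
    by (simp add: critical_clique_graph_def)
  have ex: "\<exists>x. x \<in> Q \<and> x \<in> pverts H" if Q: "Q \<in> pverts ?K" for Q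
  proof -
    have cQ: "critical_clique (with_proj G) Q" using Q crit by blast
    then have "Q \<noteq> {}" by (simp add: critical_clique_def)
    then obtain u where u: "u \<in> Q" by blast
    then have "u \<in> pverts (add_true_twins H T)"
      using critical_clique_subset[OF cQ] by (simp flip: G_eq)
    then obtain x where x: "x \<in> pverts H" "x \<in> pverts G" "true_twins (with_proj G) u x"
      using true_twin_in_base[OF T, of u] by (auto simp flip: G_eq)
    then have "x \<in> Q"
      unfolding critical_clique_eq_twin_class[OF cQ u] by (simp add: twin_class_def)
    with x(1) show ?thesis by blast
  qed
  \<comment> \<open>Choosing a vertex of \<open>H\<close> in every critical clique embeds
    \<open>CC(G)\<close> in \<open>H\<close> as an induced subgraph, so cycles carry over to
    \<open>H\<close> and their chords carry back.\<close>
  define h where "h Q = (SOME x. x \<in> Q \<and> x \<in> pverts H)" for Q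
  have h: "h Q \<in> Q" "h Q \<in> pverts H" if "Q \<in> pverts ?K" for Q
    using someI_ex[OF ex[OF that]] by (simp_all add: h_def)
  have inj: "h Q \<noteq> h R" if "Q \<in> pverts ?K" "R \<in> pverts ?K" "Q \<noteq> R" for Q R
  proof
    assume "h Q = h R"
    then have "true_twins (with_proj G) (h Q) (h R)" by (simp add: true_twins_def)
    then show False
      using critical_clique_eq_iff[of Q R "h Q" "h R"] h that crit by simp
  qed
  have adj: "(Q, R) \<in> parcs ?K \<longleftrightarrow> (h Q, h R) \<in> parcs H"
    if QR: "Q \<in> pverts ?K" "R \<in> pverts ?K" "Q \<noteq> R" for Q R
  proof -
    have "(Q, R) \<in> parcs ?K \<longleftrightarrow> (h Q, h R) \<in> parcs G"
      using critical_clique_graph_adj_iff[of Q R "h Q" "h R"] h QR crit by simp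
    then show ?thesis
      using parcs_add_true_twins_base_iff[OF T(1)] h QR inj unfolding G_eq by metis
  qed
  show ?thesis
  proof
    show "finite (pverts ?K)" using K.finite_verts by simp
  next
    fix Q R assume "(Q, R) \<in> parcs ?K"
    then show "Q \<in> pverts ?K" "(R, Q) \<in> parcs ?K"
      by (rule K_adj)+
  next
    fix Q show "(Q, Q) \<notin> parcs ?K" using K_adj(3) by blast
  next
    fix Q R assume "Q \<in> pverts ?K" "R \<in> pverts ?K"
    then show "(\<lambda>Q R. (Q, R) \<in> parcs ?K)\<^sup>*\<^sup>* Q R"
      by (rule connected_critical_clique_graph[OF G(2)])
  next
    fix Qs Q R
    assume Qs: "distinct Qs" "3 \<le> length Qs" "successively (\<lambda>Q R. (Q, R) \<in> parcs ?K) Qs"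
      "(last Qs, hd Qs) \<in> parcs ?K" and QR: "Q \<in> set Qs" "R \<in> set Qs" "Q \<noteq> R"
    have sub: "set Qs \<subseteq> pverts ?K"
      using K.closed_walk_subset_verts Qs(3,4) by simp
    have "distinct (map h Qs)"
      using Qs(1) inj sub by (auto simp: distinct_map inj_on_def subset_iff)
    moreover have "successively (dominates (with_proj H)) (map h Qs)"
      unfolding successively_map
    proof (rule successively_mono[OF Qs(3)])
      fix Q R assume "Q \<in> set Qs" "R \<in> set Qs" "(Q, R) \<in> parcs ?K"
      then show "h Q \<rightarrow>\<^bsub>with_proj H\<^esub> h R"
        using adj[of Q R] sub K_adj(3) by auto
    qed
    moreover have "last (map h Qs) \<rightarrow>\<^bsub>with_proj H\<^esub> hd (map h Qs)"
    proof -
      have "Qs \<noteq> []" using Qs(2) by auto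
      moreover from this have "last Qs \<in> pverts ?K" "hd Qs \<in> pverts ?K" using sub by auto
      moreover have "last Qs \<noteq> hd Qs" by (rule K_adj(3)[OF Qs(4)])
      ultimately show ?thesis using adj Qs(4) by (simp add: last_map hd_map)
    qed
    ultimately have "h Q \<rightarrow>\<^bsub>with_proj H\<^esub> h R"
      using block_graph_cycle_clique[OF H, of "map h Qs" "h Q" "h R"] Qs(2) QR inj sub
      by (simp add: subset_iff)
    then show "(Q, R) \<in> parcs ?K" using adj QR sub by (simp add: subset_iff)
  next
    fix Q R
    assume "Q \<in> pverts ?K" "R \<in> pverts ?K"
      "\<And>P. Q = P \<or> (Q, P) \<in> parcs ?K \<longleftrightarrow> R = P \<or> (R, P) \<in> parcs ?K"
    then show "Q = R" by (rule twin_free_critical_clique_graph)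
  qed
qed

section \<open>The derived graph and the path criterion\<close>

lemma path_graph_derived_graph_iff:
  assumes "pair_graph X"
    and S: "S = {v \<in> pverts X. \<exists>p q. (v, p) \<in> parcs X \<and> (v, q) \<in> parcs X \<and> p \<noteq> q \<and> (p, q) \<notin> parcs X}"
  shows "path_graph (derived_graph (with_proj X)) \<longleftrightarrow>
    (\<exists>xs. xs \<noteq> [] \<and> distinct xs \<and> set xs = S \<and>
      (\<forall>i<length xs. \<forall>j<length xs. (xs ! i, xs ! j) \<in> parcs X \<longleftrightarrow> j = Suc i \<or> i = Suc j))"
proof -
  interpret graph "with_proj X" by (rule graph_with_proj[OF assms(1)])
  have nbhd: "nbhd (with_proj X) v = {u. (v, u) \<in> parcs X}" for v
    using adj_in_verts(2)[of v] by (auto simp: nbhd_def)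
  have "{u. (v, u) \<in> parcs X} \<subseteq> pverts X" for v
    using adj_in_verts(2)[of v] by auto
  then have "{v \<in> pverts X. \<not> simplicial (with_proj X) v} = S"
    unfolding simplicial_def clique_def nbhd S by auto
  then have D: "derived_graph (with_proj X) = with_proj X \<restriction> S" by (simp add: derived_graph_def)
  have "graph (with_proj X \<restriction> S)" by (rule graph_induce_subgraph) (auto simp: S)
  moreover have "xs ! i \<rightarrow>\<^bsub>with_proj X \<restriction> S\<^esub> xs ! j \<longleftrightarrow> (xs ! i, xs ! j) \<in> parcs X"
    if "set xs = S" "i < length xs" "j < length xs" for xs i j
    using that nth_mem[of i xs] nth_mem[of j xs] by (simp add: dominates_induce_subgraph_iff)
  ultimately show ?thesis unfolding D path_graph_def by (simp cong: conj_cong)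
qed

theorem theorem6:
  fixes G :: "'a pair_pre_digraph"
  assumes "pair_graph G"
    and "Digraph_Component.connected (with_proj G)"
    and "\<not> complete_graph (with_proj G)"
    and "strictly_chordal G"
  shows "strictly_interval G \<longleftrightarrow>
    path_graph (derived_graph (with_proj (critical_clique_graph (with_proj G))))"
proof -
  interpret graph "with_proj G" by (rule graph_with_proj[OF assms(1)])
  let ?K = "critical_clique_graph (with_proj G)"
  interpret C: clique_cycle_graph "pverts ?K" "\<lambda>Q R. (Q, R) \<in> parcs ?K"
    using assms by (intro clique_cycle_graph_critical_cliques)
  note path = path_graph_derived_graph_iff[OF pair_graph_critical_clique_graph C.S_def]
  show ?thesis
  proof
    assume "strictly_interval G"
    then obtain J where J: "interval_model (pverts ?K) (\<lambda>Q R. (Q, R) \<in> parcs ?K) J"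
      using interval_model_critical_clique_graph unfolding strictly_interval_def by blast
    \<comment> \<open>Two vertices that are not twins supply two critical cliques, so
      \<open>S\<close> is nonempty, as the vertex set of a path has to be.\<close>
    obtain u v where uv: "u \<in> pverts G" "v \<in> pverts G" "\<not> true_twins (with_proj G) u v"
      using assms(3) complete_if_all_twins by auto
    then have "twin_class u \<in> pverts ?K" "twin_class v \<in> pverts ?K" "twin_class u \<noteq> twin_class v"
      using critical_clique_twin_class critical_clique_eq_iff[OF _ _ self_in_twin_class self_in_twin_class]
      by (auto simp: critical_clique_graph_def)
    then have "C.S \<noteq> {}" by (rule C.S_nonempty)
    then obtain xs where "xs \<noteq> []" "distinct xs" "set xs = C.S"
      "\<And>i j. \<lbrakk>i < length xs; j < length xs\<rbrakk> \<Longrightarrow>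
        (xs ! i, xs ! j) \<in> parcs ?K \<longleftrightarrow> j = Suc i \<or> i = Suc j"
      using C.S_path_if_interval[OF J] by metis
    then show "path_graph (derived_graph (with_proj ?K))" unfolding path by blast
  next
    assume "path_graph (derived_graph (with_proj ?K))"
    then obtain xs where "xs \<noteq> []" "distinct xs" "set xs = C.S"
      "\<forall>i<length xs. \<forall>j<length xs. (xs ! i, xs ! j) \<in> parcs ?K \<longleftrightarrow> j = Suc i \<or> i = Suc j"
      unfolding path by blast
    then obtain J where "interval_model (pverts ?K) (\<lambda>Q R. (Q, R) \<in> parcs ?K) J"
      using C.interval_if_S_path[of xs] by blast
    then have "interval_graph (with_proj G)" by (rule interval_graph_if_critical_clique_graph_model)
    then show "strictly_interval G" using assms(4) by (simp add: strictly_interval_def)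
  qed
qed

end
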